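(* Let $(X,d)$ be a metric space and let $\mathcal{S}$ be a bornology on $X$. Suppose $A\in CL(X)$ and $(A_{\lambda})$ is a net in $CL(X)$. If $B_d(S,f)\in\mathcal{S}$ for each $S\in\mathcal{S}$ and each $f\in L(\mathcal{Z}^+)$, then the following statements are equivalent: (i) $(A_{\lambda})$ is $\tau_{\mathcal{S},d}$-convergent to $A$; (ii) $(A_{\lambda})$ is $\mathcal{S}$-convergent to $A$; (iii) for each $S\in\mathcal{S}$, $\lim_{\lambda}e_d(A\cap S,A_{\lambda})=0$ and $\lim_{\lambda}e_d(A_{\lambda}\cap S,A)=0$; (iv) for each $S$ in some cofinal subset $\mathcal{S}_0$ of $\mathcal{S}$, $\lim_{\lambda}e_d(A\cap S,A_{\lambda})=0$ and $\lim_{\lambda}e_d(A_{\lambda}\cap S,A)=0$.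
   Context: A bornology on a metric space $(X,d)$ is a nonempty family $\mathcal{S}$ of nonempty subsets of $X$ that is hereditary (nonempty subsets of members are members), stable under finite unions, and covers $X$. $CL(X)$ is the collection of all nonempty closed subsets of $X$. $d(x,A)=\inf_{a\in A}d(x,a)$; $B_d(x,r)$ is the open ball of radius $r$; for $\epsilon>0$, $B_d(A,\epsilon)=\{x\in X: d(x,A)<\epsilon\}$. The excess is $e_d(C,A)=\sup_{x\in C}d(x,A)\in[0,\infty]$, with $e_d(\emptyset,A)=0$. A subset $\mathcal{S}_0\subseteq\mathcal{S}$ is cofinal if every member of $\mathcal{S}$ is contained in a member of $\mathcal{S}_0$. $L(\mathcal{Z}^+)$ is the set of all Lipschitz functions $f:X\to\mathbb{R}$ with $f(x)>0$ for all $x\in X$. For such $f$ and $S\subseteq X$, $B_d(S,f)=\bigcup_{x\in S}B_d(x,f(x))$. A net $(A_\lambda)$ is $\tau_{\mathcal{S},d}$-convergent to $A$ if for every $\epsilon>0$ and $S\in\mathcal{S}$, eventually $|d(x,A_\lambda)-d(x,A)|<\epsilon$ for all $x\in S$. It is $\mathcal{S}$-convergent to $A$ if for every $\epsilon>0$ and $S\in\mathcal{S}$, eventually $A\cap S\subseteq B_d(A_\lambda,\epsilon)$ and $A_\lambda\cap S\subseteq B_d(A,\epsilon)$. *)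

theory Defs
  imports "HOL-Analysis.Analysis"
begin

text \<open>The metric space is a type of class \<open>metric_space\<close>, with \<open>X = UNIV\<close> and \<open>d = dist\<close>.\<close>

definition bornology :: "'a set set \<Rightarrow> bool" where
  "bornology \<S> \<longleftrightarrow>
     \<S> \<noteq> {} \<and> {} \<notin> \<S> \<and>
     (\<forall>S\<in>\<S>. \<forall>T. T \<subseteq> S \<and> T \<noteq> {} \<longrightarrow> T \<in> \<S>) \<and>
     (\<forall>\<F>. finite \<F> \<and> \<F> \<noteq> {} \<and> \<F> \<subseteq> \<S> \<longrightarrow> \<Union>\<F> \<in> \<S>) \<and>
     \<Union>\<S> = UNIV"

definition cofinal_subfamily :: "'a set set \<Rightarrow> 'a set set \<Rightarrow> bool" where
  "cofinal_subfamily \<S>\<^sub>0 \<S> \<longleftrightarrow> \<S>\<^sub>0 \<subseteq> \<S> \<and> (\<forall>S\<in>\<S>. \<exists>T\<in>\<S>\<^sub>0. S \<subseteq> T)"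

definition CL :: "'a::metric_space set set" where
  "CL = {C. closed C \<and> C \<noteq> {}}"

text \<open>
  \<open>infdist x A\<close> is \<open>d(x,A)\<close> for nonempty \<open>A\<close>; the library sets \<open>infdist x {} = 0\<close>. In the
  definitions below, the set to which distance is measured is only ever instantiated with
  members of \<open>CL\<close>, so this convention plays no role.
\<close>

definition enlargement :: "'a::metric_space set \<Rightarrow> real \<Rightarrow> 'a set" where
  "enlargement A \<epsilon> = {x. infdist x A < \<epsilon>}"

text \<open>The supremum is taken in \<open>[0,\<infinity>]\<close>, so it is \<open>0\<close> when \<open>C\<close> is empty.\<close>

definition excess :: "'a::metric_space set \<Rightarrow> 'a set \<Rightarrow> ennreal" where
  "excess C A = (SUP x\<in>C. ennreal (infdist x A))"

definition positive_Lipschitz :: "('a::metric_space \<Rightarrow> real) set" where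
  "positive_Lipschitz = {f. (\<exists>L. L-lipschitz_on UNIV f) \<and> (\<forall>x. f x > 0)}"

definition variable_enlargement :: "'a::metric_space set \<Rightarrow> ('a \<Rightarrow> real) \<Rightarrow> 'a set" where
  "variable_enlargement S f = (\<Union>x\<in>S. ball x (f x))"

text \<open>
  A net is a function restricted to a directed index set \<open>D\<close>, which is preordered by \<open>le\<close>;
  convergence along the net is convergence along the filter generated by the tails of \<open>D\<close>.
\<close>

definition directed_set :: "'i set \<Rightarrow> ('i \<Rightarrow> 'i \<Rightarrow> bool) \<Rightarrow> bool" where
  "directed_set D le \<longleftrightarrow>
     D \<noteq> {} \<and>
     (\<forall>i\<in>D. le i i) \<and>
     (\<forall>i\<in>D. \<forall>j\<in>D. \<forall>k\<in>D. le i j \<longrightarrow> le j k \<longrightarrow> le i k) \<and>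
     (\<forall>i\<in>D. \<forall>j\<in>D. \<exists>k\<in>D. le i k \<and> le j k)"

definition tail_filter :: "'i set \<Rightarrow> ('i \<Rightarrow> 'i \<Rightarrow> bool) \<Rightarrow> 'i filter" where
  "tail_filter D le = (INF i\<in>D. principal {j\<in>D. le i j})"

lemma eventually_tail_filter:
  assumes "directed_set D le"
  shows "eventually P (tail_filter D le) \<longleftrightarrow> (\<exists>i\<in>D. \<forall>j\<in>D. le i j \<longrightarrow> P j)"
proof -
  have "eventually P (tail_filter D le) \<longleftrightarrow>
      (\<exists>i\<in>D. eventually P (principal {j\<in>D. le i j}))"
    unfolding tail_filter_def
  proof (rule eventually_INF_base)
    show "D \<noteq> {}"
      using assms by (simp add: directed_set_def)
  next
    fix i j assume ij: "i \<in> D" "j \<in> D"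
    then obtain k where k: "k \<in> D" "le i k" "le j k"
      using assms unfolding directed_set_def by blast
    have "{l\<in>D. le k l} \<subseteq> {l\<in>D. le i l} \<inter> {l\<in>D. le j l}"
      using assms ij k unfolding directed_set_def by blast
    then show "\<exists>k\<in>D. principal {l\<in>D. le k l} \<le>
        inf (principal {l\<in>D. le i l}) (principal {l\<in>D. le j l})"
      using k(1) by auto
  qed
  then show ?thesis
    by (auto simp: eventually_principal)
qed

definition tau_convergent ::
  "'a::metric_space set set \<Rightarrow> ('i \<Rightarrow> 'a set) \<Rightarrow> 'a set \<Rightarrow> 'i filter \<Rightarrow> bool" where
  "tau_convergent \<S> As A F \<longleftrightarrow>
     (\<forall>\<epsilon>>0. \<forall>S\<in>\<S>. \<forall>\<^sub>F i in F. \<forall>x\<in>S. \<bar>infdist x (As i) - infdist x A\<bar> < \<epsilon>)"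

definition bornologically_convergent ::
  "'a::metric_space set set \<Rightarrow> ('i \<Rightarrow> 'a set) \<Rightarrow> 'a set \<Rightarrow> 'i filter \<Rightarrow> bool" where
  "bornologically_convergent \<S> As A F \<longleftrightarrow>
     (\<forall>\<epsilon>>0. \<forall>S\<in>\<S>. \<forall>\<^sub>F i in F.
        A \<inter> S \<subseteq> enlargement (As i) \<epsilon> \<and> As i \<inter> S \<subseteq> enlargement A \<epsilon>)"

end

theory Submission
  imports Defs
begin

text \<open>
  A near-optimal point of \<open>A\<close> seen from \<open>x \<in> S\<close> lies in \<open>T = B(S, d(\<cdot>,A) + 2\<epsilon>)\<close>, which again
  belongs to the bornology since \<open>d(\<cdot>,A) + 2\<epsilon>\<close> is a positive Lipschitz function. Applying
  bornological convergence to \<open>T\<close> therefore bounds \<open>d(x,A\<^sub>\<lambda>)\<close> by \<open>d(x,A) + \<epsilon>\<close>. This bound in turn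
  places the near-optimal points of \<open>A\<^sub>\<lambda>\<close> in \<open>T\<close>, which gives the reverse estimate.
\<close>

text \<open>An infimum strictly below \<open>r\<close> is undercut by some point. Nonemptiness
  matters because \<open>infdist x {} = 0\<close> in the library.\<close>

lemma ex_dist_less_of_infdist_less:
  assumes "A \<noteq> {}" "infdist x A < r"
  obtains a where "a \<in> A" "dist x a < r"
  using assms by (auto simp: infdist_def cINF_less_iff)

text \<open>The distance to a set is 1-Lipschitz; the constant keeps the function positive where
  that distance vanishes.\<close>

lemma infdist_plus_const_positive_Lipschitz:
  assumes "c > 0"
  shows "(\<lambda>x. infdist x A + c) \<in> positive_Lipschitz"
proof -
  have "1-lipschitz_on UNIV (\<lambda>x. infdist x A + c)"
    by (rule lipschitz_onI) (simp_all add: dist_real_def infdist_triangle_abs)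
  then show ?thesis
    using assms infdist_nonneg[of _ A] by (auto simp: positive_Lipschitz_def add_nonneg_pos)
qed

lemma CL_nonempty: "A \<in> CL \<Longrightarrow> A \<noteq> {}"
  by (simp add: CL_def)

lemma excess_mono: "B \<subseteq> C \<Longrightarrow> excess B A \<le> excess C A"
  unfolding excess_def by (rule SUP_subset_mono) auto

text \<open>Both arguments of the excess may vary with the index, so this translation serves both
  limits: the one measured to \<open>As i\<close> and the one measured to the fixed
  \<open>A\<close>.\<close>

lemma excess_tendsto_0_iff:
  "((\<lambda>i. excess (C i) (B i)) \<longlongrightarrow> 0) F \<longleftrightarrow>
     (\<forall>\<epsilon>>0. \<forall>\<^sub>F i in F. C i \<subseteq> enlargement (B i) \<epsilon>)"
proof
  assume lim: "((\<lambda>i. excess (C i) (B i)) \<longlongrightarrow> 0) F"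
  show "\<forall>\<epsilon>>0. \<forall>\<^sub>F i in F. C i \<subseteq> enlargement (B i) \<epsilon>"
  proof (intro allI impI)
    fix \<epsilon> :: real assume "\<epsilon> > 0"
    then have "\<forall>\<^sub>F i in F. excess (C i) (B i) < ennreal \<epsilon>"
      by (intro order_tendstoD(2)[OF lim]) simp
    then show "\<forall>\<^sub>F i in F. C i \<subseteq> enlargement (B i) \<epsilon>"
    proof eventually_elim
      case (elim i)
      have "ennreal (infdist x (B i)) < ennreal \<epsilon>" if "x \<in> C i" for x
        using elim SUP_upper[OF that, of "\<lambda>x. ennreal (infdist x (B i))"]
        by (simp add: excess_def)
      then show ?case
        by (auto simp: enlargement_def ennreal_less_iff infdist_nonneg)
    qed
  qed
next
  assume small: "\<forall>\<epsilon>>0. \<forall>\<^sub>F i in F. C i \<subseteq> enlargement (B i) \<epsilon>"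
  show "((\<lambda>i. excess (C i) (B i)) \<longlongrightarrow> 0) F"
  proof (rule order_tendstoI)
    fix a :: ennreal assume "0 < a"
    \<comment> \<open>Pointwise strict bounds give only a non-strict bound on the supremum, hence an
      \<open>r\<close> strictly below \<open>a\<close>; being below \<open>a\<close>, it is also
      finite.\<close>
    then obtain r where r: "0 < r" "r < a"
      using dense by blast
    then obtain \<epsilon> where \<epsilon>: "r = ennreal \<epsilon>" "\<epsilon> > 0"
      by (cases r) auto
    have "\<forall>\<^sub>F i in F. C i \<subseteq> enlargement (B i) \<epsilon>"
      using small \<epsilon>(2) by blast
    then show "\<forall>\<^sub>F i in F. excess (C i) (B i) < a"
    proof eventually_elim
      case (elim i)
      then have "excess (C i) (B i) \<le> r"
        unfolding excess_def \<epsilon>(1)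
        by (intro SUP_least ennreal_leI) (auto simp: enlargement_def intro: less_imp_le)
      then show ?case
        using r(2) by (rule le_less_trans)
    qed
  qed simp
qed

lemma bornologically_convergent_iff_excess:
  "bornologically_convergent \<S> As A F \<longleftrightarrow>
     (\<forall>S\<in>\<S>. ((\<lambda>i. excess (A \<inter> S) (As i)) \<longlongrightarrow> 0) F \<and>
             ((\<lambda>i. excess (As i \<inter> S) A) \<longlongrightarrow> 0) F)"
  unfolding bornologically_convergent_def excess_tendsto_0_iff eventually_conj_iff by blast

lemma excess_tendsto_0_mono:
  assumes "((\<lambda>i. excess (C i) (B i)) \<longlongrightarrow> 0) F" and "\<And>i. C' i \<subseteq> C i"
  shows "((\<lambda>i. excess (C' i) (B i)) \<longlongrightarrow> 0) F"
  using assms(2) by (intro tendsto_sandwich[OF _ _ tendsto_const assms(1)])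
    (auto intro!: always_eventually excess_mono)

text \<open>At points of \<open>A\<close> the term \<open>infdist x A\<close> is 0, at points of
  \<open>As i\<close> the term \<open>infdist x (As i)\<close> is 0, so the uniform estimate on
  \<open>S\<close> yields both inclusions.\<close>

lemma tau_convergent_imp_bornologically_convergent:
  assumes "tau_convergent \<S> As A F"
  shows "bornologically_convergent \<S> As A F"
  unfolding bornologically_convergent_def
proof (intro allI impI ballI)
  fix \<epsilon> :: real and S assume "\<epsilon> > 0" "S \<in> \<S>"
  then have "\<forall>\<^sub>F i in F. \<forall>x\<in>S. \<bar>infdist x (As i) - infdist x A\<bar> < \<epsilon>"
    using assms by (auto simp: tau_convergent_def)
  then show "\<forall>\<^sub>F i in F. A \<inter> S \<subseteq> enlargement (As i) \<epsilon> \<and> As i \<inter> S \<subseteq> enlargement A \<epsilon>"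
    by eventually_elim (force simp: enlargement_def)
qed

lemma abs_infdist_diff_less:
  assumes "A \<noteq> {}" "B \<noteq> {}" "\<epsilon> > 0" "x \<in> S"
    and T: "T = variable_enlargement S (\<lambda>x. infdist x A + 2 * \<epsilon>)"
    and AT: "A \<inter> T \<subseteq> enlargement B (\<epsilon> / 2)"
    and BT: "B \<inter> T \<subseteq> enlargement A (\<epsilon> / 2)"
  shows "\<bar>infdist x B - infdist x A\<bar> < \<epsilon>"
proof -
  have in_T: "y \<in> T" if "dist x y < infdist x A + 2 * \<epsilon>" for y
    using that \<open>x \<in> S\<close> unfolding T variable_enlargement_def by auto
  obtain a where a: "a \<in> A" "dist x a < infdist x A + \<epsilon> / 2"
    using ex_dist_less_of_infdist_less[OF \<open>A \<noteq> {}\<close>, of x "infdist x A + \<epsilon> / 2"] \<open>\<epsilon> > 0\<close> by auto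
  have "a \<in> T"
    using a(2) \<open>\<epsilon> > 0\<close> by (intro in_T) linarith
  then have "infdist a B < \<epsilon> / 2"
    using AT a(1) by (auto simp: enlargement_def)
  then have upper: "infdist x B < infdist x A + \<epsilon>"
    using infdist_triangle[of x B a] a(2) by linarith
  obtain b where b: "b \<in> B" "dist x b < infdist x B + \<epsilon> / 2"
    using ex_dist_less_of_infdist_less[OF \<open>B \<noteq> {}\<close>, of x "infdist x B + \<epsilon> / 2"] \<open>\<epsilon> > 0\<close> by auto
  \<comment> \<open>The radius allows for this point: \<open>dist x b\<close> is below
    \<open>infdist x A + 3/2 * \<epsilon>\<close>, hence below
    \<open>infdist x A + 2 * \<epsilon>\<close>.\<close>
  have "b \<in> T"
    using b(2) upper \<open>\<epsilon> > 0\<close> by (intro in_T) linarith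
  then have "infdist b A < \<epsilon> / 2"
    using BT b(1) by (auto simp: enlargement_def)
  then have "infdist x A < infdist x B + \<epsilon>"
    using infdist_triangle[of x A b] b(2) by linarith
  with upper show ?thesis
    by linarith
qed

lemma bornologically_convergent_imp_tau_convergent:
  assumes conv: "bornologically_convergent \<S> As A F"
    and stable: "\<And>S f. S \<in> \<S> \<Longrightarrow> f \<in> positive_Lipschitz \<Longrightarrow> variable_enlargement S f \<in> \<S>"
    and "A \<noteq> {}" and nonempty: "\<forall>\<^sub>F i in F. As i \<noteq> {}"
  shows "tau_convergent \<S> As A F"
  unfolding tau_convergent_def
proof (intro allI impI ballI)
  fix \<epsilon> :: real and S assume "\<epsilon> > 0" "S \<in> \<S>"
  \<comment> \<open>\<open>T\<close> depends on \<open>S\<close> and \<epsilon> but not on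
    \<open>x\<close>, so one tail of the net works for all \<open>x\<close> in
    \<open>S\<close>.\<close>
  define T where "T = variable_enlargement S (\<lambda>x. infdist x A + 2 * \<epsilon>)"
  have "T \<in> \<S>"
    unfolding T_def using \<open>\<epsilon> > 0\<close> \<open>S \<in> \<S>\<close>
    by (intro stable infdist_plus_const_positive_Lipschitz) auto
  then have "\<forall>\<^sub>F i in F. A \<inter> T \<subseteq> enlargement (As i) (\<epsilon> / 2) \<and> As i \<inter> T \<subseteq> enlargement A (\<epsilon> / 2)"
    using conv \<open>\<epsilon> > 0\<close> by (simp add: bornologically_convergent_def)
  then show "\<forall>\<^sub>F i in F. \<forall>x\<in>S. \<bar>infdist x (As i) - infdist x A\<bar> < \<epsilon>"
    using nonempty
    by eventually_elim (use \<open>A \<noteq> {}\<close> \<open>\<epsilon> > 0\<close> T_def in \<open>blast intro: abs_infdist_diff_less\<close>)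
qed

theorem theorem3p19:
  fixes \<S> :: "'a::metric_space set set"
    and A :: "'a set"
    and As :: "'i \<Rightarrow> 'a set"
    and D :: "'i set"
    and le :: "'i \<Rightarrow> 'i \<Rightarrow> bool"
  defines "F \<equiv> tail_filter D le"
  defines "i_stmt \<equiv> tau_convergent \<S> As A F"
    and "ii_stmt \<equiv> bornologically_convergent \<S> As A F"
    and "iii_stmt \<equiv> (\<forall>S\<in>\<S>. ((\<lambda>i. excess (A \<inter> S) (As i)) \<longlongrightarrow> 0) F \<and>
                           ((\<lambda>i. excess (As i \<inter> S) A) \<longlongrightarrow> 0) F)"
    and "iv_stmt \<equiv> (\<exists>\<S>\<^sub>0. cofinal_subfamily \<S>\<^sub>0 \<S> \<and>
                     (\<forall>S\<in>\<S>\<^sub>0. ((\<lambda>i. excess (A \<inter> S) (As i)) \<longlongrightarrow> 0) F \<and>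
                             ((\<lambda>i. excess (As i \<inter> S) A) \<longlongrightarrow> 0) F))"
  assumes "bornology \<S>"
    and "A \<in> CL"
    and "directed_set D le"
    and "\<forall>i\<in>D. As i \<in> CL"
    and "\<forall>S\<in>\<S>. \<forall>f\<in>positive_Lipschitz. variable_enlargement S f \<in> \<S>"
  shows "(i_stmt \<longleftrightarrow> ii_stmt) \<and> (ii_stmt \<longleftrightarrow> iii_stmt) \<and> (iii_stmt \<longleftrightarrow> iv_stmt)"
proof (intro conjI)
  \<comment> \<open>\<open>As\<close> is constrained only on \<open>D\<close>, so nonemptiness is
    available along the filter; any index of \<open>D\<close> starts a suitable tail.\<close>
  have "\<forall>\<^sub>F i in F. As i \<noteq> {}"
    using \<open>directed_set D le\<close> \<open>\<forall>i\<in>D. As i \<in> CL\<close>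
    unfolding F_def eventually_tail_filter[OF \<open>directed_set D le\<close>] directed_set_def CL_def
    by blast
  then show "i_stmt \<longleftrightarrow> ii_stmt"
    unfolding i_stmt_def ii_stmt_def
    using tau_convergent_imp_bornologically_convergent[of \<S> As A F]
      bornologically_convergent_imp_tau_convergent[of \<S> As A F]
      CL_nonempty[OF \<open>A \<in> CL\<close>]
      \<open>\<forall>S\<in>\<S>. \<forall>f\<in>positive_Lipschitz. variable_enlargement S f \<in> \<S>\<close>
    by blast
  show "ii_stmt \<longleftrightarrow> iii_stmt"
    unfolding ii_stmt_def iii_stmt_def by (rule bornologically_convergent_iff_excess)
  show "iii_stmt \<longleftrightarrow> iv_stmt"
  proof
    show "iv_stmt" if "iii_stmt"
      \<comment> \<open>The whole family is cofinal in itself.\<close>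
      using that unfolding iii_stmt_def iv_stmt_def cofinal_subfamily_def by blast
    show "iii_stmt" if "iv_stmt"
      unfolding iii_stmt_def
    proof
      fix S assume "S \<in> \<S>"
      \<comment> \<open>Excess is monotone in its first argument, so both limits pass from a cofinal
        member \<open>T\<close> down to \<open>S\<close>.\<close>
      with \<open>iv_stmt\<close> obtain T where "S \<subseteq> T"
        and lims: "((\<lambda>i. excess (A \<inter> T) (As i)) \<longlongrightarrow> 0) F"
          "((\<lambda>i. excess (As i \<inter> T) A) \<longlongrightarrow> 0) F"
        unfolding iv_stmt_def cofinal_subfamily_def by blast
      then show "((\<lambda>i. excess (A \<inter> S) (As i)) \<longlongrightarrow> 0) F \<and>
          ((\<lambda>i. excess (As i \<inter> S) A) \<longlongrightarrow> 0) F"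
        by (intro conjI excess_tendsto_0_mono[OF lims(1)] excess_tendsto_0_mono[OF lims(2)]) auto
    qed
  qed
qed

end
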